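(* Let $q$ be a prime power with $\gcd(q,6)=1$. Then: (a) $F_1(X):=X-\frac13\mathrm{Tr}_{q^2/q}(X^{2q-1})$ permutes $\mathbb{F}_{q^2}$; (b) for any nonsquare $\nu\in\mathbb{F}_q$, the function $x\mapsto \dfrac{x(x^2-9\nu)}{x^2-\nu}$ permutes $\mathbb{F}_q$; (c) $g(X):=\dfrac{X^3-3X^2+1}{X^3-3X+1}$ permutes the set $\mu_{q+1}$ of $(q+1)$-th roots of unity in $\mathbb{F}_{q^2}^*$.
   Context: $\mathrm{Tr}_{q^2/q}(X)$ denotes the polynomial $X^q+X$. "Permutes" means the induced map on the given set is well-defined and bijective. *)

theory Defs
  imports
    "HOL-Library.Cardinality"
    "HOL-Computational_Algebra.Computational_Algebra"
    "HOL-Number_Theory.Prime_Powers"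
begin

definition Tr_poly :: "nat \<Rightarrow> 'a::comm_ring_1 poly" where
  "Tr_poly q = monom 1 q + monom 1 1"

definition F1_poly :: "nat \<Rightarrow> 'a::field poly" where
  "F1_poly q = monom 1 1 - smult (1 / 3) (pcompose (Tr_poly q) (monom 1 (2 * q - 1)))"

definition mu :: "nat \<Rightarrow> 'a::field set" where
  "mu n = {x. x ^ n = 1}"

text \<open>
  Since \<open>x / 0 = 0\<close> in HOL, being well-defined on \<open>S\<close> is expressed by the
  denominator having no zero in \<open>S\<close>.
\<close>
definition quotient_permutes :: "('a::field \<Rightarrow> 'a) \<Rightarrow> ('a \<Rightarrow> 'a) \<Rightarrow> 'a set \<Rightarrow> bool" where
  "quotient_permutes n d S \<longleftrightarrow>
     (\<forall>x\<in>S. d x \<noteq> 0) \<and> bij_betw (\<lambda>x. n x / d x) S S"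

end

theory Submission
  imports Defs
begin

text \<open>
  All three maps are degree-three functions whose fibres are governed by a quadratic in two
  variables that cannot vanish off the diagonal.
  In (b), \<open>g x = g y\<close> with \<open>x \<noteq> y\<close> gives \<open>(x y + 3 \<nu>)\<^sup>2 = \<nu> (x - y)\<^sup>2\<close>, so \<open>\<nu>\<close> is a square.
  In (c), it gives \<open>(x y - y + 1) (x y - x + 1) = 0\<close>; on \<open>\<mu>\<^sub>q\<^sub>+\<^sub>1\<close> the Frobenius map
  \<open>x \<mapsto> x ^ q\<close> is inversion and swaps the two factors up to units, so both vanish and \<open>x = y\<close>.
  In (a), write \<open>2 x = a + b\<close> with \<open>a = x + x ^ q\<close> and \<open>b = x - x ^ q\<close>. The value of the
  polynomial determines \<open>b\<close> because the trace term is fixed by Frobenius, and then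
  \<open>a\<close> is determined by the identity of (b) with \<open>\<nu> = b\<^sup>2\<close>: the
  square root \<open>b (a - a')\<close> is negated by Frobenius, while \<open>a a' + 3 b\<^sup>2\<close> is fixed.
\<close>

section \<open>The cubic quotient with a nonsquare parameter\<close>

lemma nonsquare_quotient_permutes:
  fixes \<nu> :: "'a::{field,finite}"
  assumes "\<not> is_square \<nu>"
  shows "quotient_permutes (\<lambda>x. x * (x ^ 2 - 9 * \<nu>)) (\<lambda>x. x ^ 2 - \<nu>) UNIV"
proof -
  have denom: "x ^ 2 - \<nu> \<noteq> 0" for x
    using assms by (auto simp: is_nth_power_def)
  have "x = y"
    if "x * (x ^ 2 - 9 * \<nu>) / (x ^ 2 - \<nu>) = y * (y ^ 2 - 9 * \<nu>) / (y ^ 2 - \<nu>)" for x y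
  proof (rule ccontr)
    assume "x \<noteq> y"
    have "x * (x ^ 2 - 9 * \<nu>) * (y ^ 2 - \<nu>) = y * (y ^ 2 - 9 * \<nu>) * (x ^ 2 - \<nu>)"
      using that denom by (simp add: frac_eq_eq)
    then have "(x - y) * ((x * y + 3 * \<nu>) ^ 2 - \<nu> * (x - y) ^ 2) = 0"
      by algebra
    with \<open>x \<noteq> y\<close> have "\<nu> * (x - y) ^ 2 = (x * y + 3 * \<nu>) ^ 2"
      by simp
    with \<open>x \<noteq> y\<close> have "\<nu> = ((x * y + 3 * \<nu>) / (x - y)) ^ 2"
      by (simp add: power_divide eq_divide_eq)
    with assms show False
      by (metis is_nth_powerI)
  qed
  then have "inj (\<lambda>x. x * (x ^ 2 - 9 * \<nu>) / (x ^ 2 - \<nu>))"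
    by (rule injI)
  then show ?thesis
    using denom unfolding quotient_permutes_def bij_betw_def
    by (simp add: finite_UNIV_inj_surj)
qed

text \<open>The identity behind (b) for \<open>\<nu> = b\<^sup>2\<close>; doubling \<open>x\<close> and \<open>y\<close> introduces the factor 16.\<close>
lemma trace_cubic_identity:
  fixes x y b :: "'a::idom"
  shows "(x - y) * (((x + (x - b)) * (y + (y - b)) + 3 * b ^ 2) ^ 2
            - (b * ((x + (x - b)) - (y + (y - b)))) ^ 2)
      = 16 * ((3 * x ^ 2 * (x - b) - (x - b) ^ 3 - x ^ 3) * (y * (y - b))
            - (3 * y ^ 2 * (y - b) - (y - b) ^ 3 - y ^ 3) * (x * (x - b)))"
  by algebra

section \<open>Injectivity over a field with an involution\<close>

text \<open>Abstracts conjugation \<open>x ^ q\<close> on a field of \<open>q ^ 2\<close> elements,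
  so that the polynomial identities are free of the exponent \<open>q\<close>.\<close>

locale field_involution =
  fixes c :: "'a::field \<Rightarrow> 'a"
  assumes c_one [simp]: "c 1 = 1"
    and c_add [simp]: "c (x + y) = c x + c y"
    and c_mult [simp]: "c (x * y) = c x * c y"
    and c_c [simp]: "c (c x) = x"
begin

lemma c_zero [simp]: "c 0 = 0"
  using c_add[of 0 0] by (metis add.right_neutral add_left_cancel)

lemma c_minus [simp]: "c (- x) = - c x"
  using c_add[of x "- x"] by (simp add: eq_neg_iff_add_eq_0 add.commute)

lemma c_diff [simp]: "c (x - y) = c x - c y"
  using c_add[of x "- y"] by simp

lemma c_power [simp]: "c (x ^ n) = c x ^ n"
  by (induction n) simp_all

lemma c_of_nat [simp]: "c (of_nat n) = of_nat n"
  by (induction n) simp_all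

lemma c_numeral [simp]: "c (numeral n) = numeral n"
  using c_of_nat[of "numeral n"] by simp

lemma c_eq_0_iff [simp]: "c x = 0 \<longleftrightarrow> x = 0"
  by (metis c_c c_zero)

lemma c_divide [simp]: "c (x / y) = c x / c y"
proof (cases "y = 0")
  case False
  then have "c (x / y) * c y = c x"
    by (simp flip: c_mult)
  with False show ?thesis
    by (simp add: field_simps)
qed simp

lemma unit_circle_quotient_endo_inj:
  assumes three: "(3 :: 'a) \<noteq> 0"
  defines "S \<equiv> {x. x * c x = 1}"
  defines "D \<equiv> \<lambda>x. x ^ 3 - 3 * x + 1"
  defines "g \<equiv> \<lambda>x. (x ^ 3 - 3 * x ^ 2 + 1) / D x"
  shows "\<forall>x\<in>S. D x \<noteq> 0" and "g ` S \<subseteq> S" and "inj_on g S"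
proof -
  \<comment> \<open>On \<open>S\<close>, \<open>c x\<close> is the inverse of \<open>x\<close>, so
    conjugating \<open>D\<close> reverses its coefficients, which yields the numerator of
    \<open>g\<close>. Hence numerator and denominator vanish together, and
    \<open>g x * c (g x) = 1\<close>.\<close>
  have c_D: "x ^ 3 * c (D x) = x ^ 3 - 3 * x ^ 2 + 1" if "x \<in> S" for x
  proof -
    have "x ^ 3 * c (D x) = (x * c x) ^ 3 - 3 * x ^ 2 * (x * c x) + x ^ 3"
      unfolding D_def by simp algebra
    then show ?thesis
      using that by (simp add: S_def)
  qed
  show denom: "\<forall>x\<in>S. D x \<noteq> 0"
  proof
    fix x assume x: "x \<in> S"
    show "D x \<noteq> 0"
    proof
      assume D0: "D x = 0"
      then have "x ^ 3 - 3 * x ^ 2 + 1 = 0" using c_D[OF x] by simp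
      \<comment> \<open>A common zero in \<open>S\<close> must be 1, since 0 is not in
        \<open>S\<close>; but \<open>D 1 = - 1\<close>.\<close>
      moreover have "3 * x * (x - 1) = D x - (x ^ 3 - 3 * x ^ 2 + 1)"
        unfolding D_def by algebra
      ultimately have "3 * x * (x - 1) = 0"
        using D0 by simp
      then have "x = 1" using three x by (auto simp: S_def)
      with D0 show False by (simp add: D_def)
    qed
  qed
  show "g ` S \<subseteq> S"
  proof
    fix z assume "z \<in> g ` S"
    then obtain x where x: "x \<in> S" and z: "z = g x" by blast
    have gx: "g x = x ^ 3 * c (D x) / D x"
      using c_D[OF x] by (simp add: g_def)
    have "x ^ 3 * c x ^ 3 = 1"
      using x by (simp add: S_def flip: power_mult_distrib)
    then show "z \<in> S"
      using denom x unfolding z S_def gx by (simp add: mult.commute)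
  qed
  show "inj_on g S"
  proof (rule inj_onI)
    fix x y assume x: "x \<in> S" and y: "y \<in> S" and "g x = g y"
    then have "(x ^ 3 - 3 * x ^ 2 + 1) * D y = (y ^ 3 - 3 * y ^ 2 + 1) * D x"
      using denom by (simp add: g_def frac_eq_eq)
    then have "3 * (x - y) * ((x * y - y + 1) * (x * y - x + 1)) = 0"
      unfolding D_def by algebra
    then have factors: "x = y \<or> x * y - y + 1 = 0 \<or> x * y - x + 1 = 0"
      using three by auto
    have inverses: "x * c x = 1" "y * c y = 1"
      using x y by (simp_all add: S_def)
    have "x * y * c (x * y - y + 1) = (x * c x) * (y * c y) - x * (y * c y) + x * y"
      by (simp add: algebra_simps)
    also have "\<dots> = x * y - x + 1"
      by (simp add: inverses)
    finally have "x * y - y + 1 = 0 \<longleftrightarrow> x * y - x + 1 = 0"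
      using inverses by (metis c_eq_0_iff mult_eq_0_iff zero_neq_one)
    with factors show "x = y"
      by (metis add_right_cancel diff_left_imp_eq)
  qed
qed

text \<open>With \<open>c x = x ^ q\<close> this map is that of part (a), since
  \<open>x ^ (2 * q - 1) = c x ^ 2 / x\<close>.\<close>

lemma trace_cubic_inj:
  assumes two: "(2 :: 'a) \<noteq> 0" and three: "(3 :: 'a) \<noteq> 0"
  shows "inj (\<lambda>x. x - (c x ^ 2 / x + x ^ 2 / c x) / 3)"
proof (rule injI)
  fix x y
  assume eq: "x - (c x ^ 2 / x + x ^ 2 / c x) / 3 = y - (c y ^ 2 / y + y ^ 2 / c y) / 3"
  define b where "b = x - c x"
  define s t where "s = (c x ^ 2 / x + x ^ 2 / c x) / 3" and "t = (c y ^ 2 / y + y ^ 2 / c y) / 3"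
  have "c s = s" "c t = t"
    by (simp_all add: s_def t_def add.commute)
  moreover have "x - s = y - t"
    using eq by (simp add: s_def t_def)
  ultimately have "c x - s = c y - t"
    by (metis c_diff)
  with \<open>x - s = y - t\<close> have b: "b = y - c y"
    unfolding b_def by algebra
  show "x = y"
  proof (cases "b = 0")
    case True
    \<comment> \<open>On fixed points of \<open>c\<close> the map is just \<open>z / 3\<close>. They
      are treated apart because \<open>b\<close> is cancelled in the other case.\<close>
    have third: "z - (z ^ 2 / z + z ^ 2 / z) / 3 = z / 3" for z :: 'a
      using three by (cases "z = 0") (simp_all add: field_simps power2_eq_square)
    have "c x = x" "c y = y"
      using True b by (simp_all add: b_def)
    then show ?thesis
      using eq three third[of x] third[of y] by simp
  next
    case False
    then have nz: "x \<noteq> 0" "y \<noteq> 0" using b by (auto simp: b_def)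
    define u where "u = (x + c x) * (y + c y) + 3 * b ^ 2"
    define v where "v = b * ((x + c x) - (y + c y))"
    have "z - (c z ^ 2 / z + z ^ 2 / c z) / 3
        = (3 * z ^ 2 * c z - c z ^ 3 - z ^ 3) / (z * c z) / 3" if "z \<noteq> 0" for z
      using that three by (simp add: field_simps power2_eq_square power3_eq_cube)
    then have "(3 * x ^ 2 * c x - c x ^ 3 - x ^ 3) / (x * c x)
        = (3 * y ^ 2 * c y - c y ^ 3 - y ^ 3) / (y * c y)"
      using eq nz three by (metis divide_cancel_right)
    then have "(3 * x ^ 2 * c x - c x ^ 3 - x ^ 3) * (y * c y)
        = (3 * y ^ 2 * c y - c y ^ 3 - y ^ 3) * (x * c x)"
      using nz by (simp add: frac_eq_eq)
    moreover have "(x - y) * (u ^ 2 - v ^ 2)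
        = 16 * ((3 * x ^ 2 * c x - c x ^ 3 - x ^ 3) * (y * c y)
              - (3 * y ^ 2 * c y - c y ^ 3 - y ^ 3) * (x * c x))"
    proof -
      have "c x = x - b" by (simp add: b_def)
      moreover have "c y = y - b" by (simp add: b)
      ultimately show ?thesis
        unfolding u_def v_def by (simp only: trace_cubic_identity)
    qed
    ultimately have "(x - y) * (u ^ 2 - v ^ 2) = 0"
      by simp
    moreover have "x = y" if "u = v \<or> u = - v"
    proof -
      have "c b = - b" by (simp add: b_def)
      then have "c u = u" "c v = - v"
        by (simp_all add: u_def v_def add.commute)
      \<comment> \<open>Applying \<open>c\<close> to either equation flips the sign of
        \<open>v\<close> only, so both equations hold.\<close>
      with that have "v = - v" by auto
      then have "2 * v = 0" by algebra
      then have "x + c x = y + c y"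
        using two False by (simp add: v_def)
      moreover have "x - c x = y - c y"
        using b by (simp add: b_def)
      ultimately have "2 * (x - y) = 0"
        by algebra
      then show ?thesis using two by simp
    qed
    ultimately show ?thesis
      by (auto simp: power2_eq_iff)
  qed
qed

end

section \<open>Finite fields and the Frobenius map\<close>

text \<open>
  The library has this fact for the class \<open>finite_field\<close>, which is not implied by the sort
  \<open>{field, finite}\<close>.
\<close>
lemma power_CARD_eq_self:
  fixes x :: "'a::{field,finite}"
  shows "x ^ CARD('a) = x"
proof (cases "x = 0")
  case False
  let ?U = "UNIV - {0 :: 'a}"
  \<comment> \<open>Multiplication by \<open>x\<close> permutes the nonzero elements; their product
    then cancels.\<close>
  have "bij_betw ((*) x) ?U ?U"
    using False by (intro bij_betwI[of _ _ _ "\<lambda>y. y / x"]) auto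
  then have "(\<Prod>y\<in>?U. x * y) = \<Prod>?U"
    using prod.reindex_bij_betw[of "(*) x" ?U ?U "\<lambda>y. y"] by simp
  then have "x ^ card ?U = 1"
    by (simp add: prod.distrib)
  moreover have "CARD('a) = Suc (card ?U)"
    by (rule card.remove) auto
  ultimately show ?thesis
    by (simp only: power_Suc mult_1_right)
qed simp

text \<open>Translation by 1 permutes the ring, so comparing the sums of all elements gives
  \<open>of_nat CARD('a) = 0\<close>.\<close>

lemma CHAR_dvd_CARD: "CHAR('a::{ring_1,finite}) dvd CARD('a)"
proof -
  have "(\<Sum>x\<in>UNIV. x + 1) = (\<Sum>x\<in>UNIV. x :: 'a)"
    by (rule sum.reindex_bij_witness[of _ "\<lambda>x. x - 1" "\<lambda>x. x + 1"]) auto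
  then have "of_nat (CARD('a)) = (0 :: 'a)"
    by (simp add: sum.distrib)
  then show ?thesis
    by (simp add: of_nat_eq_0_iff_char_dvd)
qed

lemma CHAR_eq_if_CARD_eq_prime_power:
  assumes "prime p" and "CARD('a::{field,finite}) = p ^ n"
  shows "CHAR('a) = p"
proof -
  have "prime CHAR('a)"
    by (intro prime_CHAR_semidom finite_imp_CHAR_pos) simp
  moreover have "CHAR('a) dvd p ^ n"
    using CHAR_dvd_CARD[where ?'a = 'a] assms(2) by simp
  ultimately show ?thesis
    using assms(1) by (metis prime_dvd_power primes_dvd_imp_eq)
qed

text \<open>Additivity holds because \<open>q\<close> is a power of the characteristic; applying the
  map twice gives \<open>x ^ (q ^ 2) = x\<close>.\<close>

lemma Frobenius_involution:
  assumes "primepow q" and "CARD('a::{field,finite}) = q ^ 2"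
  shows "field_involution (\<lambda>x :: 'a. x ^ q)"
proof
  obtain p n where p: "prime p" and q: "q = p ^ n"
    using assms(1) by (auto simp: primepow_def)
  have "CHAR('a) = p"
    using p assms(2) by (intro CHAR_eq_if_CARD_eq_prime_power[of _ "n * 2"]) (simp_all add: q power_mult)
  then show "(x + y) ^ q = x ^ q + y ^ q" for x y :: 'a
    using p q by (intro freshmans_dream') auto
  show "(x ^ q) ^ q = x" for x :: 'a
    using power_CARD_eq_self[of x] assms(2) by (simp add: power2_eq_square power_mult)
qed (simp_all add: power_mult_distrib)

lemma of_nat_neq_0_if_coprime_CARD:
  assumes "coprime (CARD('a::{field,finite})) n"
  shows "(of_nat n :: 'a) \<noteq> 0"
proof
  assume "of_nat n = (0 :: 'a)"
  then have "CHAR('a) dvd n"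
    by (simp add: of_nat_eq_0_iff_char_dvd)
  then have "is_unit (CHAR('a))"
    using assms CHAR_dvd_CARD by (meson coprime_common_divisor)
  then show False
    by simp
qed

text \<open>The quotient form is also right at \<open>x = 0\<close>: both sides of
  \<open>x ^ (2 * q - 1) = (x ^ q) ^ 2 / x\<close> are 0 there, as
  \<open>2 * q - 1 > 0\<close>.\<close>

lemma poly_F1_poly:
  fixes x :: "'a::field"
  assumes "q > 0"
  shows "poly (F1_poly q) x = x - ((x ^ q) ^ 2 / x + ((x ^ q) ^ 2 / x) ^ q) / 3"
proof -
  have "x ^ (2 * q - 1) = (x ^ q) ^ 2 / x"
  proof (cases "x = 0")
    case False
    then show ?thesis
      using assms by (simp add: power_diff power_mult mult.commute[of 2])
  qed (use assms in simp)
  then show ?thesis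
    by (simp add: F1_poly_def Tr_poly_def poly_monom poly_pcompose add.commute)
qed

theorem theorem3p1:
  fixes q :: nat
  assumes "primepow q"
    and "gcd q 6 = 1"
    and "CARD('k::{field,finite}) = q"
    and "CARD('l::{field,finite}) = q ^ 2"
  shows "bij_betw (poly (F1_poly q :: 'l poly)) UNIV UNIV
    \<and> (\<forall>\<nu> :: 'k. \<not> is_square \<nu> \<longrightarrow>
          quotient_permutes (\<lambda>x. x * (x ^ 2 - 9 * \<nu>)) (\<lambda>x. x ^ 2 - \<nu>) UNIV)
    \<and> quotient_permutes (\<lambda>x. x ^ 3 - 3 * x ^ 2 + 1) (\<lambda>x. x ^ 3 - 3 * x + 1)
          (mu (q + 1) :: 'l set)"
proof -
  have inv: "field_involution (\<lambda>x :: 'l. x ^ q)"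
    using assms(1,4) by (rule Frobenius_involution)
  have "coprime q (2 * 3)"
    using assms(2) by (simp add: coprime_iff_gcd_eq_1)
  then have "coprime (CARD('l)) (2 * 3)"
    unfolding assms(4) by (rule coprime_power_left_iff[THEN iffD2, OF disjI1])
  then have "of_nat 2 \<noteq> (0 :: 'l)" "of_nat 3 \<noteq> (0 :: 'l)"
    by (simp_all only: coprime_mult_right_iff of_nat_neq_0_if_coprime_CARD not_False_eq_True)
  then have two: "(2 :: 'l) \<noteq> 0" and three: "(3 :: 'l) \<noteq> 0"
    by simp_all
  have power_commute: "(z ^ m) ^ n = (z ^ n) ^ m" for z :: 'l and m n
    by (metis power_mult mult.commute)
  have q: "q > 0"
    using assms(1) by (rule primepow_gt_0_nat)
  have "poly (F1_poly q :: 'l poly) = (\<lambda>x. x - ((x ^ q) ^ 2 / x + x ^ 2 / x ^ q) / 3)"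
    by (rule ext) (simp only: poly_F1_poly[OF q] power_divide
        power_commute[of _ 2] field_involution.c_c[OF inv])
  then have "inj (poly (F1_poly q :: 'l poly))"
    using field_involution.trace_cubic_inj[OF inv two three] by simp
  then have a: "bij (poly (F1_poly q :: 'l poly))"
    by (simp add: bij_def finite_UNIV_inj_surj)
  have mu: "(mu (q + 1) :: 'l set) = {x. x * x ^ q = 1}"
    by (simp add: mu_def)
  have c: "quotient_permutes (\<lambda>x. x ^ 3 - 3 * x ^ 2 + 1) (\<lambda>x. x ^ 3 - 3 * x + 1)
          (mu (q + 1) :: 'l set)"
    \<comment> \<open>The set is finite, so an injective self-map is onto.\<close>
    using field_involution.unit_circle_quotient_endo_inj[OF inv three]
    unfolding quotient_permutes_def mu bij_betw_def
    by (simp add: endo_inj_surj)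
  from a c nonsquare_quotient_permutes show ?thesis
    by blast
qed

end
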